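(* Let $M$ be an oriented neutral $4n$-manifold with metric $h$ and let $\nabla$ be the Levi-Civita connection of $h$. Let $\varepsilon\in\{+,-\}$ and let $J$ be an almost $\varepsilon$-paracomplex structure of $M$ such that $\nabla J$ is locally (near each point of $M$) represented by the tensor product $\alpha\otimes N$ of a $1$-form $\alpha$ and an almost $\varepsilon$-nilpotent structure $N$ related to $J$ by some $(e,\mu)$, where $e$ is an admissible frame field of $J$ and $\mu\in\{+,-\}$. Then $\|\nabla J\|^2=0$, that is, $(M,h)$ equipped with $J$ is isotropic paraKähler.
   Context: Signs $\varepsilon,\mu\in\{+,-\}$ are identified with $\pm1$. $I_n$, $O_n$ are the $n\times n$ unit and zero matrices, $I_{n,+}:=I_n$, $I_{n,-}:=\mathrm{diag}(-1,1,\dots,1)$ (so $I_{1,-}=-1$), $I'_{4n,\varepsilon}:=\mathrm{diag}(I_n,I_n,I_n,I_{n,\varepsilon})$, and $$\Lambda_n:=\begin{bmatrix}O_n&-I_n&O_n&I_n\\ I_n&O_n&I_n&O_n\\ O_n&I_n&O_n&-I_n\\ I_n&O_n&I_n&O_n\end{bmatrix}.$$ A neutral metric $h$ on $M$ has signature $(2n,2n)$. An ordered pseudo-orthonormal local frame field $e=(e_1,\dots,e_{4n})$ of $TM$ has $e_1,\dots,e_{2n}$ space-like ($h(e_i,e_i)=1$) and $e_{2n+1},\dots,e_{4n}$ time-like ($h(e_i,e_i)=-1$). Frames are written as row vectors; endomorphisms act entrywise on a row. Almost $\varepsilon$-nilpotent structure (on an open set): a section $N$ of $\mathrm{End}\,TM$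 such that near each point there is an ordered pseudo-orthonormal local frame field $e$ giving the orientation with $N(eI'_{4n,\varepsilon})=eI'_{4n,\varepsilon}\Lambda_n$; such an $e$ is an admissible frame field of $N$. Almost $\varepsilon$-paracomplex structure: a section $J$ of $\mathrm{End}\,TM$ such that (i) $J$ is an almost paracomplex structure ($J^2=\mathrm{id}$ with $\pm1$-eigenbundles of equal rank), (ii) $J$ is $h$-reversing: $h(JX,JY)=-h(X,Y)$, (iii) near each point there is an ordered pseudo-orthonormal local frame field $e$ giving the orientation with $$J(eI'_{4n,\varepsilon})=eI'_{4n,\varepsilon}\begin{bmatrix}O_n&O_n&I_n&O_n\\ O_n&O_n&O_n&-I_n\\ I_n&O_n&O_n&O_n\\ O_n&-I_n&O_n&O_n\end{bmatrix};$$ such an $e$ is an admissible frame field of $J$. For $\mu\in\{+,-\}$, $e(\mu):=(e_1,\dots,e_{2n},\mu e_{2n+1},\dots,\mu e_{4n})$. $N$ is related to $J$ by $(e,\mu)$ if $e$ is an admissible frame field of $J$ and $e(\mu)$ is an admissible frame field of $N$. The square norm is $$\|\nabla J\|^2:=\sum_{i,j=1}^{4n}\varepsilon_i\varepsilon_j\,h\bigl((\nabla_{e_i}J)(e_j),(\nabla_{e_i}J)(e_j)\bigr),$$ where $e$ is any ordered pseudo-orthonormal local frame field giving the orientation and $\varepsilon_k=1$, $\varepsilon_{2n+k}=-1$ for $k=1,\dots,2n$; it does not depend on $e$. $(M,h,J)$ is called isotropic paraKähler if $\|\nabla J\|^2=0$. *)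

theory Defs
  imports
    "HOL-Analysis.Analysis"
    "HOL-Library.Function_Algebras"
    "Jordan_Normal_Form.Determinant"
begin

section \<open>Functions with values in a real vector space\<close>

text \<open>
  Tangent vectors are derivations, hence functions. The pointwise operations make them elements
  of a real vector space, so that \<^const>\<open>span\<close>, \<^const>\<open>independent\<close> and \<^const>\<open>dim\<close> apply.
\<close>

instantiation "fun" :: (type, real_vector) real_vector
begin

definition scaleR_fun :: "real \<Rightarrow> ('a \<Rightarrow> 'b) \<Rightarrow> 'a \<Rightarrow> 'b"
  where "scaleR_fun c f = (\<lambda>x. c *\<^sub>R f x)"

instance
  by standard (simp_all add: scaleR_fun_def fun_eq_iff scaleR_add_right scaleR_add_left)

end


section \<open>Smooth manifolds\<close>

text \<open>On an open set of a finite-dimensional space, this is the usual notion of class \<open>C\<^sup>k\<close>.\<close>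

primrec Ck_on :: "nat \<Rightarrow> 'e::euclidean_space set \<Rightarrow> ('e \<Rightarrow> 'f::real_normed_vector) \<Rightarrow> bool" where
  "Ck_on 0 S f \<longleftrightarrow> continuous_on S f"
| "Ck_on (Suc k) S f \<longleftrightarrow>
     (\<forall>x\<in>S. f differentiable (at x)) \<and> (\<forall>v. Ck_on k S (\<lambda>x. frechet_derivative f (at x) v))"

definition Cinf_on :: "'e::euclidean_space set \<Rightarrow> ('e \<Rightarrow> 'f::real_normed_vector) \<Rightarrow> bool"
  where "Cinf_on S f \<longleftrightarrow> (\<forall>k. Ck_on k S f)"

text \<open>
  The points of a manifold are the points of \<open>man_top\<close>; the atlas consists of pairs of a chart domain
  and a chart map, and is not required to be maximal.
\<close>

record ('p, 'e) manifold =
  man_top :: "'p topology"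
  atlas :: "('p set \<times> ('p \<Rightarrow> 'e)) set"

abbreviation points :: "('p, 'e) manifold \<Rightarrow> 'p set"
  where "points M \<equiv> topspace (man_top M)"

abbreviation open_in :: "('p, 'e) manifold \<Rightarrow> 'p set \<Rightarrow> bool"
  where "open_in M U \<equiv> openin (man_top M) U"

definition smooth_manifold :: "('p, 'e::euclidean_space) manifold \<Rightarrow> bool" where
  "smooth_manifold M \<longleftrightarrow>
     Hausdorff_space (man_top M) \<and> second_countable (man_top M) \<and>
     (\<Union>(U, \<phi>)\<in>atlas M. U) = points M \<and>
     (\<forall>(U, \<phi>)\<in>atlas M. open_in M U \<and> open (\<phi> ` U) \<and>
        homeomorphic_map (subtopology (man_top M) U) (top_of_set (\<phi> ` U)) \<phi>) \<and>
     (\<forall>(U, \<phi>)\<in>atlas M. \<forall>(V, \<psi>)\<in>atlas M. Cinf_on (\<phi> ` (U \<inter> V)) (\<psi> \<circ> inv_into U \<phi>))"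

definition smooth_fun :: "('p, 'e::euclidean_space) manifold \<Rightarrow> 'p set \<Rightarrow> ('p \<Rightarrow> real) \<Rightarrow> bool" where
  "smooth_fun M W f \<longleftrightarrow> (\<forall>(U, \<phi>)\<in>atlas M. Cinf_on (\<phi> ` (U \<inter> W)) (f \<circ> inv_into U \<phi>))"

definition smooth_near :: "('p, 'e::euclidean_space) manifold \<Rightarrow> 'p \<Rightarrow> ('p \<Rightarrow> real) \<Rightarrow> bool" where
  "smooth_near M p f \<longleftrightarrow> (\<exists>U. open_in M U \<and> p \<in> U \<and> smooth_fun M U f)"


section \<open>Tangent vectors and tensor fields\<close>

text \<open>
  A tangent vector at a point is a derivation of the germs of smooth functions there, extended by
  0 to the functions that are not smooth near the point.
\<close>

type_synonym 'p tvec = "('p \<Rightarrow> real) \<Rightarrow> real"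

definition tangent_space :: "('p, 'e::euclidean_space) manifold \<Rightarrow> 'p \<Rightarrow> 'p tvec set" where
  "tangent_space M p = {D.
     (\<forall>f. \<not> smooth_near M p f \<longrightarrow> D f = 0) \<and>
     (\<forall>f g U. smooth_near M p f \<and> open_in M U \<and> p \<in> U \<and> (\<forall>q\<in>U. f q = g q) \<longrightarrow> D f = D g) \<and>
     (\<forall>f g. smooth_near M p f \<and> smooth_near M p g \<longrightarrow>
        D (\<lambda>q. f q + g q) = D f + D g \<and>
        D (\<lambda>q. f q * g q) = f p * D g + D f * g p) \<and>
     (\<forall>c f. smooth_near M p f \<longrightarrow> D (\<lambda>q. c * f q) = c * D f)}"

definition linear_on_tangent ::
  "('p, 'e::euclidean_space) manifold \<Rightarrow> 'p \<Rightarrow> ('p tvec \<Rightarrow> 'b::real_vector) \<Rightarrow> bool" where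
  "linear_on_tangent M p F \<longleftrightarrow>
     (\<forall>v\<in>tangent_space M p. \<forall>w\<in>tangent_space M p. F (v + w) = F v + F w) \<and>
     (\<forall>c. \<forall>v\<in>tangent_space M p. F (c *\<^sub>R v) = c *\<^sub>R F v)"

text \<open>
  Local objects on an open set \<open>U\<close> are total functions whose values outside \<open>U\<close> are irrelevant.
\<close>

definition vector_field ::
  "('p, 'e::euclidean_space) manifold \<Rightarrow> 'p set \<Rightarrow> ('p \<Rightarrow> 'p tvec) \<Rightarrow> bool" where
  "vector_field M U X \<longleftrightarrow>
     (\<forall>p\<in>U. X p \<in> tangent_space M p) \<and>
     (\<forall>W f. open_in M W \<and> W \<subseteq> U \<and> smooth_fun M W f \<longrightarrow> smooth_fun M W (\<lambda>q. X q f))"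

definition one_form ::
  "('p, 'e::euclidean_space) manifold \<Rightarrow> 'p set \<Rightarrow> ('p \<Rightarrow> 'p tvec \<Rightarrow> real) \<Rightarrow> bool" where
  "one_form M U \<alpha> \<longleftrightarrow>
     (\<forall>p\<in>U. linear_on_tangent M p (\<alpha> p)) \<and>
     (\<forall>W X. open_in M W \<and> W \<subseteq> U \<and> vector_field M W X \<longrightarrow> smooth_fun M W (\<lambda>q. \<alpha> q (X q)))"

definition endo_field ::
  "('p, 'e::euclidean_space) manifold \<Rightarrow> 'p set \<Rightarrow> ('p \<Rightarrow> 'p tvec \<Rightarrow> 'p tvec) \<Rightarrow> bool" where
  "endo_field M U F \<longleftrightarrow>
     (\<forall>p\<in>U. linear_on_tangent M p (F p) \<and> F p ` tangent_space M p \<subseteq> tangent_space M p) \<and>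
     (\<forall>W X. open_in M W \<and> W \<subseteq> U \<and> vector_field M W X \<longrightarrow> vector_field M W (\<lambda>q. F q (X q)))"

definition lie_bracket ::
  "('p, 'e::euclidean_space) manifold \<Rightarrow> ('p \<Rightarrow> 'p tvec) \<Rightarrow> ('p \<Rightarrow> 'p tvec) \<Rightarrow> 'p \<Rightarrow> 'p tvec" where
  "lie_bracket M X Y p =
     (\<lambda>f. if smooth_near M p f then X p (\<lambda>q. Y q f) - Y p (\<lambda>q. X q f) else 0)"


section \<open>Frames, orientations and neutral metrics\<close>

text \<open>Frames and matrices are indexed from 0.\<close>

definition tangent_basis ::
  "('p, 'e::euclidean_space) manifold \<Rightarrow> nat \<Rightarrow> 'p \<Rightarrow> (nat \<Rightarrow> 'p tvec) \<Rightarrow> bool" where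
  "tangent_basis M m p b \<longleftrightarrow>
     inj_on b {..<m} \<and> independent (b ` {..<m}) \<and> span (b ` {..<m}) = tangent_space M p"

definition same_orientation ::
  "nat \<Rightarrow> (nat \<Rightarrow> 'p tvec) \<Rightarrow> (nat \<Rightarrow> 'p tvec) \<Rightarrow> bool" where
  "same_orientation m b b' \<longleftrightarrow>
     (\<exists>P\<in>carrier_mat m m. Determinant.det P > 0 \<and>
        (\<forall>j<m. b' j = (\<Sum>i<m. (P $$ (i, j)) *\<^sub>R b i)))"

text \<open>
  An orientation assigns to each point a class of bases of the tangent space, the positive ones,
  such that near each point there is a smooth frame field that is positive everywhere.
\<close>

definition orientation ::
  "('p, 'e::euclidean_space) manifold \<Rightarrow> nat \<Rightarrow> ('p \<Rightarrow> (nat \<Rightarrow> 'p tvec) set) \<Rightarrow> bool" where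
  "orientation M m ori \<longleftrightarrow>
     (\<forall>p\<in>points M.
        (\<forall>b\<in>ori p. tangent_basis M m p b) \<and>
        (\<forall>b\<in>ori p. \<forall>b'. tangent_basis M m p b' \<longrightarrow> (b' \<in> ori p \<longleftrightarrow> same_orientation m b b')) \<and>
        (\<exists>U e. open_in M U \<and> p \<in> U \<and> (\<forall>i<m. vector_field M U (e i)) \<and>
           (\<forall>q\<in>U. (\<lambda>i. e i q) \<in> ori q)))"

text \<open>The sign \<open>h(e\<^sub>i,e\<^sub>i)\<close> of the \<open>i\<close>-th vector of a pseudo-orthonormal frame in signature \<open>(2n,2n)\<close>.\<close>

definition causal_sign :: "nat \<Rightarrow> nat \<Rightarrow> real"
  where "causal_sign n i = (if i < 2 * n then 1 else - 1)"

type_synonym 'p metric = "'p \<Rightarrow> 'p tvec \<Rightarrow> 'p tvec \<Rightarrow> real"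

definition pseudo_orthonormal :: "nat \<Rightarrow> 'p metric \<Rightarrow> 'p \<Rightarrow> (nat \<Rightarrow> 'p tvec) \<Rightarrow> bool" where
  "pseudo_orthonormal n h p b \<longleftrightarrow>
     (\<forall>i<4 * n. \<forall>j<4 * n. h p (b i) (b j) = (if i = j then causal_sign n i else 0))"

definition neutral_metric ::
  "('p, 'e::euclidean_space) manifold \<Rightarrow> nat \<Rightarrow> 'p metric \<Rightarrow> bool" where
  "neutral_metric M n h \<longleftrightarrow>
     (\<forall>p\<in>points M.
        (\<forall>v\<in>tangent_space M p. linear_on_tangent M p (h p v)) \<and>
        (\<forall>v\<in>tangent_space M p. \<forall>w\<in>tangent_space M p. h p v w = h p w v) \<and>
        (\<exists>b. tangent_basis M (4 * n) p b \<and> pseudo_orthonormal n h p b)) \<and>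
     (\<forall>U X Y. open_in M U \<and> vector_field M U X \<and> vector_field M U Y \<longrightarrow>
        smooth_fun M U (\<lambda>p. h p (X p) (Y p)))"

definition oriented_neutral_manifold ::
  "('p, 'e::euclidean_space) manifold \<Rightarrow> nat \<Rightarrow> 'p metric \<Rightarrow> ('p \<Rightarrow> (nat \<Rightarrow> 'p tvec) set) \<Rightarrow> bool"
  where
  "oriented_neutral_manifold M n h ori \<longleftrightarrow>
     smooth_manifold M \<and> DIM('e) = 4 * n \<and> neutral_metric M n h \<and> orientation M (4 * n) ori"

text \<open>Ordered pseudo-orthonormal frame fields on \<open>U\<close> giving the orientation.\<close>

definition oriented_frame ::
  "('p, 'e::euclidean_space) manifold \<Rightarrow> nat \<Rightarrow> 'p metric \<Rightarrow> ('p \<Rightarrow> (nat \<Rightarrow> 'p tvec) set)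
    \<Rightarrow> 'p set \<Rightarrow> (nat \<Rightarrow> 'p \<Rightarrow> 'p tvec) \<Rightarrow> bool" where
  "oriented_frame M n h ori U e \<longleftrightarrow>
     (\<forall>i<4 * n. vector_field M U (e i)) \<and>
     (\<forall>p\<in>U. pseudo_orthonormal n h p (\<lambda>i. e i p) \<and> (\<lambda>i. e i p) \<in> ori p)"


section \<open>The Levi-Civita connection\<close>

text \<open>
  A connection acts on vector fields on arbitrary open sets, compatibly with restriction: this is
  the condition that values depend only on the values of the arguments on an open set.
\<close>

type_synonym 'p connection = "('p \<Rightarrow> 'p tvec) \<Rightarrow> ('p \<Rightarrow> 'p tvec) \<Rightarrow> 'p \<Rightarrow> 'p tvec"

definition affine_connection :: "('p, 'e::euclidean_space) manifold \<Rightarrow> 'p connection \<Rightarrow> bool" where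
  "affine_connection M nabla \<longleftrightarrow>
     (\<forall>U X Y. open_in M U \<and> vector_field M U X \<and> vector_field M U Y \<longrightarrow>
        vector_field M U (nabla X Y) \<and>
        (\<forall>X' Y'. (\<forall>p\<in>U. X p = X' p \<and> Y p = Y' p) \<longrightarrow> (\<forall>p\<in>U. nabla X Y p = nabla X' Y' p)) \<and>
        (\<forall>Z. vector_field M U Z \<longrightarrow> (\<forall>p\<in>U.
           nabla (\<lambda>q. X q + Z q) Y p = nabla X Y p + nabla Z Y p \<and>
           nabla X (\<lambda>q. Y q + Z q) p = nabla X Y p + nabla X Z p)) \<and>
        (\<forall>f. smooth_fun M U f \<longrightarrow> (\<forall>p\<in>U.
           nabla (\<lambda>q. f q *\<^sub>R X q) Y p = f p *\<^sub>R nabla X Y p \<and>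
           nabla X (\<lambda>q. f q *\<^sub>R Y q) p = X p f *\<^sub>R Y p + f p *\<^sub>R nabla X Y p)))"

definition levi_civita ::
  "('p, 'e::euclidean_space) manifold \<Rightarrow> 'p metric \<Rightarrow> 'p connection \<Rightarrow> bool" where
  "levi_civita M h nabla \<longleftrightarrow>
     affine_connection M nabla \<and>
     (\<forall>U X Y. open_in M U \<and> vector_field M U X \<and> vector_field M U Y \<longrightarrow>
        (\<forall>p\<in>U. nabla X Y p - nabla Y X p = lie_bracket M X Y p)) \<and>
     (\<forall>U X Y Z. open_in M U \<and> vector_field M U X \<and> vector_field M U Y \<and> vector_field M U Z \<longrightarrow>
        (\<forall>p\<in>U. X p (\<lambda>q. h q (Y q) (Z q)) = h p (nabla X Y p) (Z p) + h p (Y p) (nabla X Z p)))"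

text \<open>\<open>(\<nabla>\<^sub>X F)(Y) = \<nabla>\<^sub>X (F Y) - F (\<nabla>\<^sub>X Y)\<close>\<close>

definition nabla_endo ::
  "'p connection \<Rightarrow> ('p \<Rightarrow> 'p tvec \<Rightarrow> 'p tvec) \<Rightarrow> ('p \<Rightarrow> 'p tvec) \<Rightarrow> ('p \<Rightarrow> 'p tvec) \<Rightarrow> 'p \<Rightarrow> 'p tvec"
  where
  "nabla_endo nabla F X Y p = nabla X (\<lambda>q. F q (Y q)) p - F p (nabla X Y p)"

definition nabla_endo_is_tensor ::
  "('p, 'e::euclidean_space) manifold \<Rightarrow> 'p connection \<Rightarrow> ('p \<Rightarrow> 'p tvec \<Rightarrow> 'p tvec)
    \<Rightarrow> 'p set \<Rightarrow> ('p \<Rightarrow> 'p tvec \<Rightarrow> real) \<Rightarrow> ('p \<Rightarrow> 'p tvec \<Rightarrow> 'p tvec) \<Rightarrow> bool" where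
  "nabla_endo_is_tensor M nabla F U \<alpha> N \<longleftrightarrow>
     (\<forall>W X Y. open_in M W \<and> W \<subseteq> U \<and> vector_field M W X \<and> vector_field M W Y \<longrightarrow>
        (\<forall>p\<in>W. nabla_endo nabla F X Y p = \<alpha> p (X p) *\<^sub>R N p (Y p)))"


section \<open>Nilpotent and paracomplex structures\<close>

text \<open>Signs are the real numbers 1 and -1.\<close>

definition I_eps :: "nat \<Rightarrow> real \<Rightarrow> real mat" where
  "I_eps n \<epsilon> = mat n n (\<lambda>(i, j). if i \<noteq> j then 0 else if i = 0 then \<epsilon> else 1)"

definition I'_eps :: "nat \<Rightarrow> real \<Rightarrow> real mat" where
  "I'_eps n \<epsilon> = diag_block_mat [1\<^sub>m n, 1\<^sub>m n, 1\<^sub>m n, I_eps n \<epsilon>]"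

definition Lambda :: "nat \<Rightarrow> real mat" where
  "Lambda n =
     four_block_mat
       (four_block_mat (0\<^sub>m n n) (- 1\<^sub>m n) (1\<^sub>m n) (0\<^sub>m n n))
       (four_block_mat (0\<^sub>m n n) (1\<^sub>m n) (1\<^sub>m n) (0\<^sub>m n n))
       (four_block_mat (0\<^sub>m n n) (1\<^sub>m n) (1\<^sub>m n) (0\<^sub>m n n))
       (four_block_mat (0\<^sub>m n n) (- 1\<^sub>m n) (1\<^sub>m n) (0\<^sub>m n n))"

definition paracomplex_mat :: "nat \<Rightarrow> real mat" where
  "paracomplex_mat n =
     four_block_mat
       (four_block_mat (0\<^sub>m n n) (0\<^sub>m n n) (0\<^sub>m n n) (0\<^sub>m n n))
       (four_block_mat (1\<^sub>m n) (0\<^sub>m n n) (0\<^sub>m n n) (- 1\<^sub>m n))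
       (four_block_mat (1\<^sub>m n) (0\<^sub>m n n) (0\<^sub>m n n) (- 1\<^sub>m n))
       (four_block_mat (0\<^sub>m n n) (0\<^sub>m n n) (0\<^sub>m n n) (0\<^sub>m n n))"

text \<open>The product of a row of vector fields with a matrix.\<close>

definition row_mult :: "(nat \<Rightarrow> 'p \<Rightarrow> 'p tvec) \<Rightarrow> real mat \<Rightarrow> nat \<Rightarrow> 'p \<Rightarrow> 'p tvec" where
  "row_mult e A j p = (\<Sum>i<dim_row A. (A $$ (i, j)) *\<^sub>R e i p)"

text \<open>The frame equation \<open>F (e I') = (e I') A\<close> on \<open>U\<close>, where \<open>I'\<close> depends on the sign.\<close>

definition frame_equation ::
  "nat \<Rightarrow> real \<Rightarrow> real mat \<Rightarrow> 'p set \<Rightarrow> ('p \<Rightarrow> 'p tvec \<Rightarrow> 'p tvec) \<Rightarrow> (nat \<Rightarrow> 'p \<Rightarrow> 'p tvec) \<Rightarrow> bool"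
  where
  "frame_equation n \<epsilon> A U F e \<longleftrightarrow>
     (\<forall>p\<in>U. \<forall>j<4 * n.
        F p (row_mult e (I'_eps n \<epsilon>) j p) = row_mult (row_mult e (I'_eps n \<epsilon>)) A j p)"

definition nilpotent_admissible ::
  "('p, 'e::euclidean_space) manifold \<Rightarrow> nat \<Rightarrow> 'p metric \<Rightarrow> ('p \<Rightarrow> (nat \<Rightarrow> 'p tvec) set) \<Rightarrow> real
    \<Rightarrow> 'p set \<Rightarrow> ('p \<Rightarrow> 'p tvec \<Rightarrow> 'p tvec) \<Rightarrow> (nat \<Rightarrow> 'p \<Rightarrow> 'p tvec) \<Rightarrow> bool" where
  "nilpotent_admissible M n h ori \<epsilon> U N e \<longleftrightarrow>
     oriented_frame M n h ori U e \<and> frame_equation n \<epsilon> (Lambda n) U N e"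

definition almost_nilpotent ::
  "('p, 'e::euclidean_space) manifold \<Rightarrow> nat \<Rightarrow> 'p metric \<Rightarrow> ('p \<Rightarrow> (nat \<Rightarrow> 'p tvec) set) \<Rightarrow> real
    \<Rightarrow> 'p set \<Rightarrow> ('p \<Rightarrow> 'p tvec \<Rightarrow> 'p tvec) \<Rightarrow> bool" where
  "almost_nilpotent M n h ori \<epsilon> U N \<longleftrightarrow>
     endo_field M U N \<and>
     (\<forall>p\<in>U. \<exists>V e. open_in M V \<and> p \<in> V \<and> V \<subseteq> U \<and> nilpotent_admissible M n h ori \<epsilon> V N e)"

definition paracomplex_admissible ::
  "('p, 'e::euclidean_space) manifold \<Rightarrow> nat \<Rightarrow> 'p metric \<Rightarrow> ('p \<Rightarrow> (nat \<Rightarrow> 'p tvec) set) \<Rightarrow> real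
    \<Rightarrow> 'p set \<Rightarrow> ('p \<Rightarrow> 'p tvec \<Rightarrow> 'p tvec) \<Rightarrow> (nat \<Rightarrow> 'p \<Rightarrow> 'p tvec) \<Rightarrow> bool" where
  "paracomplex_admissible M n h ori \<epsilon> U J e \<longleftrightarrow>
     oriented_frame M n h ori U e \<and> frame_equation n \<epsilon> (paracomplex_mat n) U J e"

definition almost_paracomplex ::
  "('p, 'e::euclidean_space) manifold \<Rightarrow> 'p set \<Rightarrow> ('p \<Rightarrow> 'p tvec \<Rightarrow> 'p tvec) \<Rightarrow> bool" where
  "almost_paracomplex M U J \<longleftrightarrow>
     endo_field M U J \<and>
     (\<forall>p\<in>U. (\<forall>v\<in>tangent_space M p. J p (J p v) = v) \<and>
        dim {v\<in>tangent_space M p. J p v = v} = dim {v\<in>tangent_space M p. J p v = - v})"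

definition almost_eps_paracomplex ::
  "('p, 'e::euclidean_space) manifold \<Rightarrow> nat \<Rightarrow> 'p metric \<Rightarrow> ('p \<Rightarrow> (nat \<Rightarrow> 'p tvec) set) \<Rightarrow> real
    \<Rightarrow> 'p set \<Rightarrow> ('p \<Rightarrow> 'p tvec \<Rightarrow> 'p tvec) \<Rightarrow> bool" where
  "almost_eps_paracomplex M n h ori \<epsilon> U J \<longleftrightarrow>
     almost_paracomplex M U J \<and>
     (\<forall>p\<in>U. \<forall>v\<in>tangent_space M p. \<forall>w\<in>tangent_space M p. h p (J p v) (J p w) = - h p v w) \<and>
     (\<forall>p\<in>U. \<exists>V e. open_in M V \<and> p \<in> V \<and> V \<subseteq> U \<and> paracomplex_admissible M n h ori \<epsilon> V J e)"

definition signed_frame ::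
  "nat \<Rightarrow> real \<Rightarrow> (nat \<Rightarrow> 'p \<Rightarrow> 'p tvec) \<Rightarrow> nat \<Rightarrow> 'p \<Rightarrow> 'p tvec" where
  "signed_frame n \<mu> e i p = (if i < 2 * n then e i p else \<mu> *\<^sub>R e i p)"

definition related_by ::
  "('p, 'e::euclidean_space) manifold \<Rightarrow> nat \<Rightarrow> 'p metric \<Rightarrow> ('p \<Rightarrow> (nat \<Rightarrow> 'p tvec) set) \<Rightarrow> real
    \<Rightarrow> 'p set \<Rightarrow> ('p \<Rightarrow> 'p tvec \<Rightarrow> 'p tvec) \<Rightarrow> ('p \<Rightarrow> 'p tvec \<Rightarrow> 'p tvec)
    \<Rightarrow> (nat \<Rightarrow> 'p \<Rightarrow> 'p tvec) \<Rightarrow> real \<Rightarrow> bool" where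
  "related_by M n h ori \<epsilon> U N J e \<mu> \<longleftrightarrow>
     paracomplex_admissible M n h ori \<epsilon> U J e \<and>
     nilpotent_admissible M n h ori \<epsilon> U N (signed_frame n \<mu> e)"


section \<open>The square norm\<close>

definition frame_square_norm ::
  "nat \<Rightarrow> 'p metric \<Rightarrow> 'p connection \<Rightarrow> ('p \<Rightarrow> 'p tvec \<Rightarrow> 'p tvec) \<Rightarrow> (nat \<Rightarrow> 'p \<Rightarrow> 'p tvec) \<Rightarrow> 'p \<Rightarrow> real"
  where
  "frame_square_norm n h nabla J e p =
     (\<Sum>i<4 * n. \<Sum>j<4 * n. causal_sign n i * causal_sign n j *
        h p (nabla_endo nabla J (e i) (e j) p) (nabla_endo nabla J (e i) (e j) p))"

text \<open>
  The description operator picks the common value of the sum over all oriented pseudo-orthonormal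
  frame fields near the point.
\<close>

definition nabla_square_norm ::
  "('p, 'e::euclidean_space) manifold \<Rightarrow> nat \<Rightarrow> 'p metric \<Rightarrow> ('p \<Rightarrow> (nat \<Rightarrow> 'p tvec) set)
    \<Rightarrow> 'p connection \<Rightarrow> ('p \<Rightarrow> 'p tvec \<Rightarrow> 'p tvec) \<Rightarrow> 'p \<Rightarrow> real" where
  "nabla_square_norm M n h ori nabla J p =
     (THE s. \<forall>U e. open_in M U \<and> p \<in> U \<and> oriented_frame M n h ori U e \<longrightarrow>
        frame_square_norm n h nabla J e p = s)"

definition isotropic_para_kaehler ::
  "('p, 'e::euclidean_space) manifold \<Rightarrow> nat \<Rightarrow> 'p metric \<Rightarrow> ('p \<Rightarrow> (nat \<Rightarrow> 'p tvec) set)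
    \<Rightarrow> 'p connection \<Rightarrow> ('p \<Rightarrow> 'p tvec \<Rightarrow> 'p tvec) \<Rightarrow> bool" where
  "isotropic_para_kaehler M n h ori nabla J \<longleftrightarrow>
     (\<forall>p\<in>points M. nabla_square_norm M n h ori nabla J p = 0)"

end

theory Submission
  imports Defs
begin

text \<open>
  The image of an almost nilpotent structure is totally isotropic: in an admissible frame \<open>f\<close>, row
  \<open>2n + k\<close> of \<^const>\<open>Lambda\<close> is plus or minus row \<open>k\<close>, so the contributions of the space-like and
  of the time-like vectors to \<open>h(N f\<^sub>i, N f\<^sub>j)\<close> cancel. Hence \<open>\<nabla>J = \<alpha> \<otimes> N\<close> takes values in null
  vectors, and every term of the square norm vanishes.
\<close>

lemma vector_field_subset:
  assumes "vector_field M U X" "W \<subseteq> U"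
  shows "vector_field M W X"
  using assms unfolding vector_field_def by blast

section \<open>The matrix \<open>Lambda\<close> and the neutral form on its columns\<close>

lemma Lambda_row_shift:
  assumes k: "k < 2 * n" and j: "j < 4 * n"
  shows "Lambda n $$ (k + 2 * n, j) = (if k < n then - 1 else 1) * Lambda n $$ (k, j)"
proof -
  define A :: "real mat"
    where "A = four_block_mat (0\<^sub>m n n) (- 1\<^sub>m n) (1\<^sub>m n) (0\<^sub>m n n)"
  define B :: "real mat"
    where "B = four_block_mat (0\<^sub>m n n) (1\<^sub>m n) (1\<^sub>m n) (0\<^sub>m n n)"
  have dims: "dim_row A = 2 * n" "dim_col A = 2 * n" "dim_row B = 2 * n" "dim_col B = 2 * n"
    by (simp_all add: A_def B_def)
  \<comment> \<open>\<open>A\<close> and \<open>B\<close> differ only in the sign of their upper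
    half. As this sign is its own inverse, the one relation serves both column halves of the block
    matrix with rows \<open>A B\<close> and \<open>B A\<close>.\<close>
  have AB: "A $$ (k, l) = (if k < n then - 1 else 1) * B $$ (k, l)" if "l < 2 * n" for l
    using k that by (cases "k < n"; cases "l < n") (simp_all add: A_def B_def)
  have "Lambda n = four_block_mat A B B A"
    by (simp only: Lambda_def A_def B_def)
  then show ?thesis
    using k j AB[of j] AB[of "j - 2 * n"] by (cases "j < 2 * n") (simp_all add: dims)
qed

lemma dim_row_Lambda: "dim_row (Lambda n) = 4 * n"
  by (simp add: Lambda_def)

text \<open>For \<open>m = 2 * n\<close> this pairs each space-like index with a time-like
  one.\<close>

lemma sum_lessThan_double:
  fixes g :: "nat \<Rightarrow> 'a::comm_monoid_add"
  shows "(\<Sum>k<m + m. g k) = (\<Sum>k<m. g k + g (k + m))"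
proof -
  have "(\<Sum>k<m + m. g k) = (\<Sum>k<m. g k) + (\<Sum>k=m..<m + m. g k)"
    by (simp add: lessThan_atLeast0 sum.atLeastLessThan_concat)
  also have "(\<Sum>k=m..<m + m. g k) = (\<Sum>k<m. g (k + m))"
    using sum.shift_bounds_nat_ivl[of g 0 m m] by (simp add: lessThan_atLeast0)
  finally show ?thesis
    by (simp add: sum.distrib)
qed

text \<open>The terms \<open>k\<close> and \<open>k + 2 * n\<close> cancel: the sign relating the
  two rows occurs twice in the product of two entries and drops out, while
  \<open>causal_sign\<close> changes.\<close>

lemma Lambda_columns_isotropic:
  assumes "i < 4 * n" "j < 4 * n"
  shows "(\<Sum>k<4 * n. causal_sign n k * Lambda n $$ (k, i) * Lambda n $$ (k, j)) = 0"
proof -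
  have "4 * n = 2 * n + 2 * n" by simp
  then show ?thesis
    using assms
    by (simp only: sum_lessThan_double)
      (auto intro!: sum.neutral simp: Lambda_row_shift causal_sign_def)
qed

section \<open>The sign matrix \<open>I'_eps\<close>\<close>

lemma dim_row_I'_eps: "dim_row (I'_eps n \<epsilon>) = 4 * n"
  by (simp add: I'_eps_def I_eps_def Let_def)

lemma dim_mat_diag: "dim_row (mat_diag m d) = m" "dim_col (mat_diag m d) = m"
  by (simp_all add: mat_diag_def)

text \<open>Folds the nested blocks of \<open>I'_eps\<close> into a single \<open>mat_diag\<close>,
  whose entries can be read off.\<close>

lemma four_block_mat_diag:
  "four_block_mat (mat_diag m d) (0\<^sub>m m k) (0\<^sub>m k m) (mat_diag k d')
    = mat_diag (m + k) (\<lambda>i. if i < m then d i else d' (i - m))"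
  by (rule eq_matI) (auto simp: mat_diag_def)

lemma I'_eps_index:
  assumes "i < 4 * n" "j < 4 * n"
  shows "I'_eps n \<epsilon> $$ (i, j) = (if i \<noteq> j then 0 else if i = 3 * n then \<epsilon> else 1)"
proof -
  have one: "1\<^sub>m n = mat_diag n (\<lambda>_. 1 :: real)"
    by (simp add: one_mat_def mat_diag_def)
  have I: "I_eps n \<epsilon> = mat_diag n (\<lambda>i. if i = 0 then \<epsilon> else 1)"
    by (rule eq_matI) (auto simp: I_eps_def mat_diag_def)
  \<comment> \<open>The recursion of \<open>diag_block_mat\<close> ends in the empty matrix, which
    must be a \<open>mat_diag\<close> too for the folding to start; the value 0 is
    arbitrary.\<close>
  have zero: "0\<^sub>m 0 0 = mat_diag 0 (\<lambda>_. 0 :: real)"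
    by (rule eq_matI) (auto simp: mat_diag_def)
  have "I'_eps n \<epsilon> = mat_diag (n + (n + (n + (n + 0)))) (\<lambda>i. if i < n then 1 else
      if i - n < n then 1 else if i - n - n < n then 1 else
      if i - n - n - n < n then if i - n - n - n = 0 then \<epsilon> else 1 else 0)"
    by (simp only: I'_eps_def I one zero diag_block_mat.simps Let_def four_block_mat_diag
        dim_mat_diag)
  then show ?thesis
    using assms by (auto simp: mat_diag_def)
qed

lemma row_mult_I'_eps:
  assumes "j < 4 * n"
  shows "row_mult e (I'_eps n \<epsilon>) j p = (if j = 3 * n then \<epsilon> else 1) *\<^sub>R e j p"
proof -
  have "row_mult e (I'_eps n \<epsilon>) j p
      = (\<Sum>i<4 * n. if i = j then (if j = 3 * n then \<epsilon> else 1) *\<^sub>R e j p else 0)"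
    unfolding row_mult_def dim_row_I'_eps
    using assms by (intro sum.cong) (simp_all add: I'_eps_index)
  then show ?thesis
    using assms by simp
qed

section \<open>Linear algebra on tangent spaces\<close>

lemma linear_on_tangent_sum:
  fixes m :: nat
  assumes "linear_on_tangent M p F" "subspace (tangent_space M p)"
    and "\<And>i. i < m \<Longrightarrow> v i \<in> tangent_space M p"
  shows "F (\<Sum>i<m. c i *\<^sub>R v i) = (\<Sum>i<m. c i *\<^sub>R F (v i))"
  using assms(3)
proof (induction m)
  case 0
  \<comment> \<open>That \<open>F\<close> maps 0 to 0 comes from homogeneity with the scalar
    0.\<close>
  have "F (0 *\<^sub>R 0) = 0 *\<^sub>R F 0"
    using assms(1) subspace_0[OF assms(2)] unfolding linear_on_tangent_def by blast
  then show ?case by (simp only: lessThan_0 sum.empty scaleR_zero_left)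
next
  case (Suc m)
  have v: "v m \<in> tangent_space M p"
    using Suc.prems by blast
  have cv: "c i *\<^sub>R v i \<in> tangent_space M p" if "i < Suc m" for i
    using Suc.prems[OF that] by (rule subspace_scale[OF assms(2)])
  \<comment> \<open>Additivity of \<open>F\<close> is known on tangent vectors only, so the partial
    sum must be shown to be one.\<close>
  have "(\<Sum>i<m. c i *\<^sub>R v i) \<in> tangent_space M p"
    using cv by (intro subspace_sum[OF assms(2)]) simp
  then have "F (\<Sum>i<Suc m. c i *\<^sub>R v i) = F (\<Sum>i<m. c i *\<^sub>R v i) + F (c m *\<^sub>R v m)"
    using assms(1) cv[of m] unfolding linear_on_tangent_def sum.lessThan_Suc by blast
  also have "F (c m *\<^sub>R v m) = c m *\<^sub>R F (v m)"
    using assms(1) v unfolding linear_on_tangent_def by blast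
  also have "F (\<Sum>i<m. c i *\<^sub>R v i) = (\<Sum>i<m. c i *\<^sub>R F (v i))"
    using Suc.prems by (intro Suc.IH) simp
  finally show ?case
    by (simp only: sum.lessThan_Suc)
qed

text \<open>The subspace property is not derived from the definition by derivations: the tangent
  space is the span of the pseudo-orthonormal basis that a neutral metric provides.\<close>

lemma neutral_metric_tangent_space:
  assumes "neutral_metric M n h" "p \<in> points M"
  shows "v \<in> tangent_space M p \<Longrightarrow> linear_on_tangent M p (h p v)"
    and "v \<in> tangent_space M p \<Longrightarrow> w \<in> tangent_space M p \<Longrightarrow> h p v w = h p w v"
    and "subspace (tangent_space M p)"
proof -
  note * = bspec[OF conjunct1[OF assms(1)[unfolded neutral_metric_def]] assms(2)]
  show "v \<in> tangent_space M p \<Longrightarrow> linear_on_tangent M p (h p v)"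
    using conjunct1[OF *] by (rule bspec)
  show "v \<in> tangent_space M p \<Longrightarrow> w \<in> tangent_space M p \<Longrightarrow> h p v w = h p w v"
    using conjunct1[OF conjunct2[OF *]] by simp
  from conjunct2[OF conjunct2[OF *]] obtain b where "tangent_basis M (4 * n) p b"
    by (elim exE conjE)
  then have "span (b ` {..<4 * n}) = tangent_space M p"
    by (simp only: tangent_basis_def)
  then show "subspace (tangent_space M p)"
    using subspace_span[of "b ` {..<4 * n}"] by (simp only:)
qed

section \<open>Isotropy of the image of \<open>N\<close>\<close>

text \<open>By bilinearity it suffices to pair the images of frame vectors; these pairings are the
  column sums of \<open>Lambda_columns_isotropic\<close>.\<close>

lemma nilpotent_admissible_isotropic:
  assumes M: "oriented_neutral_manifold M n h ori"
    and adm: "nilpotent_admissible M n h ori \<epsilon> U N g" and \<epsilon>: "\<epsilon> \<in> {1, - 1}"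
    and p: "p \<in> U" "p \<in> points M"
    and lin: "linear_on_tangent M p (N p)"
    and maps: "N p ` tangent_space M p \<subseteq> tangent_space M p"
    and v: "v \<in> tangent_space M p" and w: "w \<in> tangent_space M p"
  shows "h p (N p v) (N p w) = 0"
proof -
  let ?T = "tangent_space M p"
  \<comment> \<open>The \<open>s i\<close> are the diagonal entries of \<open>I'_eps\<close>, so
    that \<open>f\<close> below is the row \<open>g\<close> times \<open>I'_eps\<close> at
    \<open>p\<close>, in which \<open>N\<close> has the matrix \<open>Lambda n\<close>.\<close>
  define s where "s i = (if i = 3 * n then \<epsilon> else 1)" for i
  have ss: "s i * s i = 1" for i
    using \<epsilon> by (auto simp: s_def)
  define f where "f i = s i *\<^sub>R g i p" for i
  have basis: "tangent_basis M (4 * n) p (\<lambda>i. g i p)"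
    using M adm p unfolding oriented_neutral_manifold_def orientation_def
      nilpotent_admissible_def oriented_frame_def by blast
  then have span: "span ((\<lambda>i. g i p) ` {..<4 * n}) = ?T"
    by (simp add: tangent_basis_def)
  have metric: "neutral_metric M n h"
    using M by (simp add: oriented_neutral_manifold_def)
  note hlin = neutral_metric_tangent_space(1)[OF metric p(2)]
  note hsym = neutral_metric_tangent_space(2)[OF metric p(2)]
  note sub = neutral_metric_tangent_space(3)[OF metric p(2)]
  have gT: "g i p \<in> ?T" if "i < 4 * n" for i
    unfolding span[symmetric] using that by (intro span_base) auto
  then have fT: "f i \<in> ?T" if "i < 4 * n" for i
    using that sub by (simp add: f_def subspace_scale)
  have gf: "g i p = s i *\<^sub>R f i" for i
    by (simp add: f_def ss)
  have hg: "h p (g i p) (g j p) = (if i = j then causal_sign n i else 0)"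
    if "i < 4 * n" "j < 4 * n" for i j
    using adm p that
    by (auto simp: nilpotent_admissible_def oriented_frame_def pseudo_orthonormal_def)
  \<comment> \<open>Rescaling by the signs \<open>s i\<close> preserves
    pseudo-orthonormality.\<close>
  have hf: "h p (f i) (f j) = (if i = j then causal_sign n i else 0)"
    if "i < 4 * n" "j < 4 * n" for i j
  proof -
    have "h p (f i) (f j) = s j * h p (f i) (g j p)"
      using hlin[OF fT[OF that(1)]] gT[OF that(2)]
      by (simp add: f_def[of j] linear_on_tangent_def)
    \<comment> \<open>\<open>linear_on_tangent M p (h p v)\<close> is linearity in the second
      argument; here and below, the first is reached by symmetry.\<close>
    also have "h p (f i) (g j p) = h p (g j p) (f i)"
      using hsym fT gT that by blast
    also have "\<dots> = s i * h p (g j p) (g i p)"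
      using hlin[OF gT[OF that(2)]] gT[OF that(1)]
      by (simp add: f_def linear_on_tangent_def)
    finally show ?thesis
      by (cases "i = j") (simp_all add: hg that ss mult.assoc[symmetric])
  qed
  let ?L = "Lambda n"
  have Nf: "N p (f j) = (\<Sum>k<4 * n. ?L $$ (k, j) *\<^sub>R f k)" if "j < 4 * n" for j
  proof -
    have "N p (row_mult g (I'_eps n \<epsilon>) j p) = row_mult (row_mult g (I'_eps n \<epsilon>)) ?L j p"
      using adm p that by (auto simp: nilpotent_admissible_def frame_equation_def)
    then show ?thesis
      using that by (simp add: row_mult_def[where A = ?L] row_mult_I'_eps dim_row_Lambda f_def s_def)
  qed
  have NfT: "N p (f j) \<in> ?T" if "j < 4 * n" for j
    using maps fT[OF that] by blast
  have hNf: "h p (N p (f i)) (N p (f j)) = 0" if "i < 4 * n" "j < 4 * n" for i j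
  proof -
    have fN: "h p (f k) (N p (f j)) = causal_sign n k * ?L $$ (k, j)"
      if j: "j < 4 * n" and k: "k < 4 * n" for j k
    proof -
      have "h p (f k) (N p (f j)) = (\<Sum>l<4 * n. ?L $$ (l, j) *\<^sub>R h p (f k) (f l))"
        unfolding Nf[OF j] by (rule linear_on_tangent_sum[OF hlin[OF fT[OF k]] sub fT])
      also have "\<dots> = (\<Sum>l<4 * n. if l = k then causal_sign n k * ?L $$ (k, j) else 0)"
        using k by (intro sum.cong) (simp_all add: hf)
      finally show ?thesis
        using k by simp
    qed
    have "h p (N p (f i)) (N p (f j)) = h p (N p (f j)) (N p (f i))"
      using hsym NfT that by blast
    also have "\<dots> = (\<Sum>k<4 * n. ?L $$ (k, i) *\<^sub>R h p (N p (f j)) (f k))"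
      unfolding Nf[OF that(1)] by (rule linear_on_tangent_sum[OF hlin[OF NfT[OF that(2)]] sub fT])
    also have "\<dots> = (\<Sum>k<4 * n. causal_sign n k * ?L $$ (k, i) * ?L $$ (k, j))"
      using that by (intro sum.cong) (simp_all add: hsym[OF NfT fT] fN)
    also have "\<dots> = 0"
      by (rule Lambda_columns_isotropic[OF that])
    finally show ?thesis .
  qed
  have inj: "inj_on (\<lambda>i. g i p) {..<4 * n}"
    using basis by (simp add: tangent_basis_def)
  \<comment> \<open>The basis property concerns \<open>g\<close>. Since \<open>s i\<close> is its
    own inverse, a coefficient \<open>c\<close> of \<open>g i p\<close> becomes
    \<open>c * s i\<close> for \<open>f i\<close>.\<close>
  have expand: "\<exists>c. u = (\<Sum>i<4 * n. c i *\<^sub>R f i)" if "u \<in> ?T" for u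
  proof -
    have "u \<in> span ((\<lambda>i. g i p) ` {..<4 * n})"
      using that by (simp only: span)
    then obtain c where "u = (\<Sum>x\<in>(\<lambda>i. g i p) ` {..<4 * n}. c x *\<^sub>R x)"
      unfolding span_finite[OF finite_imageI[OF finite_lessThan]] by (rule rangeE)
    then have "u = (\<Sum>i<4 * n. (c (g i p) * s i) *\<^sub>R f i)"
      by (simp add: sum.reindex[OF inj] gf[symmetric] scaleR_scaleR[symmetric] del: scaleR_scaleR)
    then show ?thesis
      by (rule exI[where x = "\<lambda>i. c (g i p) * s i"])
  qed
  obtain c d where c: "v = (\<Sum>i<4 * n. c i *\<^sub>R f i)" and d: "w = (\<Sum>i<4 * n. d i *\<^sub>R f i)"
    using expand[OF v] expand[OF w] by (elim exE) (rule that)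
  have Nw: "N p w = (\<Sum>i<4 * n. d i *\<^sub>R N p (f i))"
    unfolding d by (rule linear_on_tangent_sum[OF lin sub fT])
  have Nv: "N p v = (\<Sum>i<4 * n. c i *\<^sub>R N p (f i))"
    unfolding c by (rule linear_on_tangent_sum[OF lin sub fT])
  have fNw: "h p (N p (f i)) (N p w) = 0" if "i < 4 * n" for i
  proof -
    have "h p (N p (f i)) (N p w) = (\<Sum>j<4 * n. d j *\<^sub>R h p (N p (f i)) (N p (f j)))"
      unfolding Nw by (rule linear_on_tangent_sum[OF hlin[OF NfT[OF that]] sub NfT])
    then show ?thesis
      using hNf[OF that] by simp
  qed
  have T: "N p v \<in> ?T" "N p w \<in> ?T"
    using maps v w by auto
  have "h p (N p v) (N p w) = h p (N p w) (N p v)"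
    using hsym T by blast
  also have "\<dots> = (\<Sum>i<4 * n. c i *\<^sub>R h p (N p w) (N p (f i)))"
    unfolding Nv by (rule linear_on_tangent_sum[OF hlin[OF T(2)] sub NfT])
  also have "\<dots> = 0"
    using hsym[OF T(2) NfT] fNw by simp
  finally show ?thesis .
qed

section \<open>Vanishing of the square norm\<close>

theorem theorem7p1:
  fixes M :: "('p, 'e::euclidean_space) manifold"
    and n :: nat
    and h :: "'p metric"
    and ori :: "'p \<Rightarrow> (nat \<Rightarrow> 'p tvec) set"
    and nabla :: "'p connection"
    and \<epsilon> :: real
    and J :: "'p \<Rightarrow> 'p tvec \<Rightarrow> 'p tvec"
  assumes "oriented_neutral_manifold M n h ori"
    and "levi_civita M h nabla"
    and "\<epsilon> \<in> {1, - 1}"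
    and "almost_eps_paracomplex M n h ori \<epsilon> (points M) J"
    and "\<forall>p\<in>points M. \<exists>U \<alpha> N e. \<exists>\<mu>\<in>{1, - 1}.
           open_in M U \<and> p \<in> U \<and>
           one_form M U \<alpha> \<and> almost_nilpotent M n h ori \<epsilon> U N \<and>
           related_by M n h ori \<epsilon> U N J e \<mu> \<and>
           nabla_endo_is_tensor M nabla J U \<alpha> N"
  shows "isotropic_para_kaehler M n h ori nabla J"
  unfolding isotropic_para_kaehler_def
proof
  fix p assume p: "p \<in> points M"
  obtain U \<alpha> N e \<mu> where U: "open_in M U" "p \<in> U"
    and nil: "almost_nilpotent M n h ori \<epsilon> U N"
    and rel: "related_by M n h ori \<epsilon> U N J e \<mu>"
    and tensor: "nabla_endo_is_tensor M nabla J U \<alpha> N"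
    using bspec[OF assms(5) p] by (elim exE bexE conjE) (rule that)
  have adm: "nilpotent_admissible M n h ori \<epsilon> U N (signed_frame n \<mu> e)"
    and e: "oriented_frame M n h ori U e"
    using rel by (auto simp: related_by_def paracomplex_admissible_def)
  have N: "linear_on_tangent M p (N p)" "N p ` tangent_space M p \<subseteq> tangent_space M p"
    using nil U by (auto simp: almost_nilpotent_def endo_field_def)
  have metric: "neutral_metric M n h"
    using assms(1) by (simp add: oriented_neutral_manifold_def)
  note lin_h = neutral_metric_tangent_space(1)[OF metric p]
  note sym_h = neutral_metric_tangent_space(2)[OF metric p]
  note sub = neutral_metric_tangent_space(3)[OF metric p]
  have null: "h p (N p v) (N p v) = 0" if "v \<in> tangent_space M p" for v
    by (rule nilpotent_admissible_isotropic[OF assms(1) adm assms(3) U(2) p N that that])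
  \<comment> \<open>The frame \<open>e'\<close> is arbitrary and need not be admissible, as the
    description in \<open>nabla_square_norm\<close> ranges over all oriented frames near
    \<open>p\<close>.\<close>
  have "frame_square_norm n h nabla J e' p = 0"
    if V: "open_in M V" "p \<in> V" and e': "oriented_frame M n h ori V e'" for V e'
    unfolding frame_square_norm_def
  proof (intro sum.neutral ballI)
    fix i j assume "i \<in> {..<4 * n}" "j \<in> {..<4 * n}"
    then have vf: "vector_field M V (e' i)" "vector_field M V (e' j)"
      using e' by (auto simp: oriented_frame_def)
    \<comment> \<open>The tensor formula holds inside \<open>U\<close>, while \<open>e'\<close>
      lives on \<open>V\<close>.\<close>
    have "open_in M (U \<inter> V)" using U V by blast
    moreover have "vector_field M (U \<inter> V) (e' i)" "vector_field M (U \<inter> V) (e' j)"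
      using vf vector_field_subset by blast+
    ultimately have eq: "nabla_endo nabla J (e' i) (e' j) p = \<alpha> p (e' i p) *\<^sub>R N p (e' j p)"
      using tensor U(2) V(2) unfolding nabla_endo_is_tensor_def by (meson Int_iff Int_lower1)
    define x where "x = N p (e' j p)"
    have jT: "e' j p \<in> tangent_space M p"
      using vf V by (auto simp: vector_field_def)
    then have x: "x \<in> tangent_space M p" "h p x x = 0"
      using N(2) null by (auto simp: x_def)
    have x': "a *\<^sub>R x \<in> tangent_space M p" for a
      using sub x(1) by (rule subspace_scale)
    have "h p (a *\<^sub>R x) (a *\<^sub>R x) = 0" for a
      using lin_h[OF x'] lin_h[OF x(1)] sym_h[OF x' x(1)] x by (simp add: linear_on_tangent_def)
    then show "causal_sign n i * causal_sign n j *
        h p (nabla_endo nabla J (e' i) (e' j) p) (nabla_endo nabla J (e' i) (e' j) p) = 0"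
      by (simp add: eq x_def)
  qed
  \<comment> \<open>All oriented frames near \<open>p\<close> give 0; the frame \<open>e\<close> on
    \<open>U\<close> shows that there is one, which makes the described value unique.\<close>
  then show "nabla_square_norm M n h ori nabla J p = 0"
    unfolding nabla_square_norm_def using U e by (intro the_equality) metis+
qed

end
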